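(* For all $p(t)=\sum_{k=0}^n p_kt^k$ and $q(t)=\sum_{k=0}^n q_kt^k$ in $\mathbb{R}_n[t]$ and all $\xi\in\mathbb{R}$, $$\langle p(s)\,q(t),\,K_n(\xi,s+t)\rangle_{\mathrm{ap}}=\sum_{\substack{a,b\ge0\\ a+b\le n}}p_a\,q_b\,\frac{\binom{a+b}{a}}{\binom na\binom nb}\,\binom n{a+b}\,\xi^{a+b}=(p\boxplus_n q)(\xi),$$ where $K_n(\xi,s+t)=(1+\xi(s+t))^n$.
   Context: $\mathbb{R}_n[t]$ is the space of real polynomials of degree at most $n$. For $p(t)=\sum_{k=0}^n p_kt^k$ set $\beta_n(p)_k:=p_k/\binom nk$. $\mathbb{R}_n[s,t]$ is the space of real polynomials of degree at most $n$ in each of $s$ and $t$, equipped with the tensor product apolar inner product (in the variables $s,t$, with $\xi$ a parameter), the bilinear form given on monomials by $$\langle s^it^j,s^kt^\ell\rangle_{\mathrm{ap}}=\binom nk^{-1}\binom n\ell^{-1}\delta_{ik}\,\delta_{j\ell}.$$ The finite free additive convolution is $$p\boxplus_n q:=\sum_{k=0}^n\binom nk\Bigl(\sum_{a+b=k}\binom ka\beta_n(p)_a\,\beta_n(q)_b\Bigr)t^k,$$ the inner sum being over integers $a,b\ge0$. *)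

theory Defs
  imports Complex_Main "HOL-Computational_Algebra.Polynomial"
begin

text \<open>
  The ring of bivariate polynomials in \<open>s\<close> and \<open>t\<close> is \<^typ>\<open>real poly poly\<close>:
  the outer variable is \<open>t\<close>, and the coefficients are polynomials in \<open>s\<close>.
\<close>

definition cnst :: "real \<Rightarrow> real poly poly" where
  "cnst c = [:[:c:]:]"

definition var_s :: "real poly poly" where
  "var_s = [:[:0, 1:]:]"

definition var_t :: "real poly poly" where
  "var_t = [:0, 1:]"

definition subst_var :: "real poly \<Rightarrow> real poly poly \<Rightarrow> real poly poly" where
  "subst_var p x = poly (map_poly cnst p) x"

definition coeff_st :: "real poly poly \<Rightarrow> nat \<Rightarrow> nat \<Rightarrow> real" where
  "coeff_st f i j = coeff (coeff f j) i"

definition bipoly_space :: "nat \<Rightarrow> real poly poly set" where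
  "bipoly_space n = {f. \<forall>i j. coeff_st f i j \<noteq> 0 \<longrightarrow> i \<le> n \<and> j \<le> n}"

definition apolar_mono :: "nat \<Rightarrow> nat \<Rightarrow> nat \<Rightarrow> nat \<Rightarrow> nat \<Rightarrow> real" where
  "apolar_mono n i j k l =
     inverse (real (n choose k)) * inverse (real (n choose l)) *
     (if i = k then 1 else 0) * (if j = l then 1 else 0)"

text \<open>
  The bilinear extension of \<^const>\<open>apolar_mono\<close>. It is only meaningful on
  \<^term>\<open>bipoly_space n\<close>: monomials of degree above \<open>n\<close> in either variable are ignored.
\<close>

definition apolar :: "nat \<Rightarrow> real poly poly \<Rightarrow> real poly poly \<Rightarrow> real" where
  "apolar n f g =
     (\<Sum>i\<le>n. \<Sum>j\<le>n. \<Sum>k\<le>n. \<Sum>l\<le>n. coeff_st f i j * coeff_st g k l * apolar_mono n i j k l)"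

definition apolar_kernel :: "nat \<Rightarrow> 'a::comm_semiring_1 \<Rightarrow> 'a \<Rightarrow> 'a" where
  "apolar_kernel n x y = (1 + x * y) ^ n"

definition beta_coeff :: "nat \<Rightarrow> real poly \<Rightarrow> nat \<Rightarrow> real" where
  "beta_coeff n p k = coeff p k / real (n choose k)"

definition ff_add_conv :: "nat \<Rightarrow> real poly \<Rightarrow> real poly \<Rightarrow> real poly" where
  "ff_add_conv n p q =
     (\<Sum>k\<le>n. monom (real (n choose k) *
        (\<Sum>(a, b)\<in>{(a, b). a + b = k}. real (k choose a) * beta_coeff n p a * beta_coeff n q b)) k)"

lemma coeff_st_monomial:
  "coeff_st (var_s ^ i * var_t ^ j) k l = (if k = i \<and> l = j then 1 else 0)"
proof -
  have s: "var_s ^ i = [:monom 1 i:]"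
    by (induction i) (simp_all add: var_s_def one_pCons monom_0 monom_Suc)
  have t: "var_t ^ j = monom 1 j"
    by (simp add: var_t_def monom_altdef)
  show ?thesis
    by (simp add: s t coeff_st_def)
qed

lemma apolar_monomials:
  assumes "i \<le> n" "j \<le> n" "k \<le> n" "l \<le> n"
  shows "apolar n (var_s ^ i * var_t ^ j) (var_s ^ k * var_t ^ l) = apolar_mono n i j k l"
proof -
  have "apolar n (var_s ^ i * var_t ^ j) (var_s ^ k * var_t ^ l) =
     (\<Sum>i'\<le>n. \<Sum>j'\<le>n. \<Sum>k'\<le>n. \<Sum>l'\<le>n. if l' = l then (if k' = k then (if j' = j then
        (if i' = i then apolar_mono n i j k l else 0) else 0) else 0) else 0)"
    unfolding apolar_def coeff_st_monomial by (intro sum.cong refl) auto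
  also have "\<dots> = apolar_mono n i j k l"
    using assms by (simp add: sum.delta)
  finally show ?thesis .
qed

lemma subst_var_s: "subst_var p var_s = [:p:]"
proof (induction p)
  case 0
  show ?case by (simp add: subst_var_def)
next
  case (pCons a p)
  then show ?case
    by (simp add: subst_var_def map_poly_pCons cnst_def var_s_def)
qed

lemma subst_var_t: "subst_var p var_t = map_poly (\<lambda>c. [:c:]) p"
proof (induction p)
  case 0
  show ?case by (simp add: subst_var_def)
next
  case (pCons a p)
  then show ?case
    by (simp add: subst_var_def map_poly_pCons cnst_def var_t_def)
qed

lemma product_in_bipoly_space:
  assumes "degree p \<le> n" "degree q \<le> n"
  shows "subst_var p var_s * subst_var q var_t \<in> bipoly_space n"
proof -
  have "coeff_st (subst_var p var_s * subst_var q var_t) i j = coeff p i * coeff q j" for i j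
    by (simp add: subst_var_s subst_var_t coeff_st_def coeff_map_poly mult.commute)
  then show ?thesis
    using assms by (auto simp: bipoly_space_def intro: le_trans[OF le_degree])
qed

lemma kernel_in_bipoly_space:
  "apolar_kernel n (cnst \<xi>) (var_s + var_t) \<in> bipoly_space n"
proof (induction n)
  case 0
  show ?case
    by (auto simp: apolar_kernel_def bipoly_space_def coeff_st_def split: if_splits)
next
  case (Suc n)
  let ?f = "apolar_kernel n (cnst \<xi>) (var_s + var_t)"
  have f0: "coeff (coeff ?f j) i = 0" if "i > n \<or> j > n" for i j
    using Suc that by (fastforce simp: bipoly_space_def coeff_st_def)
  have step: "apolar_kernel (Suc n) (cnst \<xi>) (var_s + var_t) =
      ?f + smult [:0, \<xi>:] ?f + pCons 0 (smult [:\<xi>:] ?f)"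
  proof -
    have "1 + cnst \<xi> * (var_s + var_t) = 1 + [:[:0, \<xi>:]:] + [:0, [:\<xi>:]:]"
      by (simp add: cnst_def var_s_def var_t_def one_pCons)
    then have "apolar_kernel (Suc n) (cnst \<xi>) (var_s + var_t) = (1 + [:[:0, \<xi>:]:] + [:0, [:\<xi>:]:]) * ?f"
      by (simp add: apolar_kernel_def)
    also have "\<dots> = ?f + [:[:0, \<xi>:]:] * ?f + [:0, [:\<xi>:]:] * ?f"
      by (simp only: distrib_right mult_1_left)
    finally show ?thesis
      by (simp only: mult_pCons_left mult_zero_left smult_0_left pCons_0_0 add_0_right add_0_left)
  qed
  have "coeff_st (apolar_kernel (Suc n) (cnst \<xi>) (var_s + var_t)) i j = 0"
    if "i > Suc n \<or> j > Suc n" for i j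
    using that unfolding step coeff_st_def
    by (auto simp: f0 coeff_pCons split: nat.split)
  then show ?case
    unfolding bipoly_space_def using not_le by blast
qed

end

theory Submission
  imports Defs
begin

text \<open>The form is diagonal in the monomials \<open>s^i t^j\<close>, with weight 1 / (C(n,i)
  C(n,j)) (\<open>apolar_eq_diagonal_sum\<close>), so only matching coefficients pair. That of
  \<open>p(s) q(t)\<close> is \<open>p_i q_j\<close>; that of the kernel is C(n,i+j) C(i+j,i)
  \<xi>^(i+j) if i + j \<le> n and 0 otherwise (\<open>coeff_st_kernel\<close>). This gives the sum
  over the triangle a + b \<le> n. Grouped by k = a + b, with the weights absorbed into
  \<open>beta_coeff\<close>, it is the convolution evaluated at \<xi>.\<close>

lemma coeff_st_mult_cnst [simp]: "coeff_st (cnst c * f) i j = c * coeff_st f i j"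
  by (simp add: coeff_st_def cnst_def)

lemma coeff_st_sum [simp]: "coeff_st (\<Sum>x\<in>A. f x) i j = (\<Sum>x\<in>A. coeff_st (f x) i j)"
  by (simp add: coeff_st_def coeff_sum)

lemma cnst_power: "cnst c ^ m = cnst (c ^ m)"
  by (induction m) (simp_all add: cnst_def one_pCons mult.commute)

text \<open>Puts the numerals produced by \<open>binomial_ring\<close> in a form that
  \<open>coeff_st_mult_cnst\<close> can pull out.\<close>

lemma of_nat_eq_cnst: "of_nat m = cnst (real m)"
  by (simp add: cnst_def of_nat_poly)

lemma coeff_st_product:
  "coeff_st (subst_var p var_s * subst_var q var_t) i j = coeff p i * coeff q j"
  by (simp add: subst_var_s subst_var_t coeff_st_def coeff_map_poly mult.commute)

lemma coeff_st_power_sum: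
  "coeff_st ((var_s + var_t) ^ m) i j = (if i + j = m then real (m choose i) else 0)"
proof -
  have "coeff_st ((var_s + var_t) ^ m) i j =
      (\<Sum>k\<le>m. real (m choose k) * (if i = k \<and> j = m - k then 1 else 0))"
    by (simp add: binomial_ring mult.assoc of_nat_eq_cnst coeff_st_monomial)
  \<comment> \<open>Since k \<le> m, the subtraction m - k is not truncated, so k = i and j = m - k
    amount to k = i and i + j = m.\<close>
  also have "\<dots> = (\<Sum>k\<le>m. if k = i then (if i + j = m then real (m choose i) else 0) else 0)"
    by (intro sum.cong) auto
  finally show ?thesis
    by auto
qed

text \<open>Two binomial expansions: of the kernel in powers of \<xi>(s + t), then of each power. By
  homogeneity only the power i + j contributes.\<close>

lemma coeff_st_kernel:
  "coeff_st (apolar_kernel n (cnst \<xi>) (var_s + var_t)) i j =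
     (if i + j \<le> n then real (n choose (i + j)) * real ((i + j) choose i) * \<xi> ^ (i + j) else 0)"
proof -
  have "apolar_kernel n (cnst \<xi>) (var_s + var_t) =
      (\<Sum>m\<le>n. cnst (real (n choose m)) * (cnst (\<xi> ^ m) * (var_s + var_t) ^ m))"
    \<comment> \<open>Moving 1 to the right makes the summation index the exponent of \<xi>(s +
      t).\<close>
    unfolding apolar_kernel_def add.commute[of 1] binomial_ring[of "cnst \<xi> * (var_s + var_t)"]
    by (simp add: power_mult_distrib cnst_power of_nat_eq_cnst mult.assoc)
  then have "coeff_st (apolar_kernel n (cnst \<xi>) (var_s + var_t)) i j =
      (\<Sum>m\<le>n. real (n choose m) * (\<xi> ^ m * (if i + j = m then real (m choose i) else 0)))"
    by (simp add: coeff_st_power_sum)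
  also have "\<dots> =
      (\<Sum>m\<le>n. if m = i + j then real (n choose (i + j)) * real ((i + j) choose i) * \<xi> ^ (i + j) else 0)"
    by (intro sum.cong) auto
  finally show ?thesis
    by simp
qed

lemma apolar_eq_diagonal_sum:
  "apolar n f g =
     (\<Sum>i\<le>n. \<Sum>j\<le>n. coeff_st f i j * coeff_st g i j / (real (n choose i) * real (n choose j)))"
proof -
  have "(\<Sum>k\<le>n. \<Sum>l\<le>n. coeff_st f i j * coeff_st g k l * apolar_mono n i j k l) =
      coeff_st f i j * coeff_st g i j / (real (n choose i) * real (n choose j))"
    if "i \<le> n" "j \<le> n" for i j
  proof -
    have "(\<Sum>k\<le>n. \<Sum>l\<le>n. coeff_st f i j * coeff_st g k l * apolar_mono n i j k l) =
        (\<Sum>k\<le>n. \<Sum>l\<le>n. if l = j then if k = i then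
           coeff_st f i j * coeff_st g i j / (real (n choose i) * real (n choose j)) else 0 else 0)"
      by (intro sum.cong refl) (auto simp: apolar_mono_def divide_inverse)
    then show ?thesis
      using that by simp
  qed
  then show ?thesis
    by (simp add: apolar_def)
qed

text \<open>Matches the inner sum of \<open>ff_add_conv\<close> to the shape that
  \<open>sum.triangle_reindex_eq\<close> yields.\<close>

lemma sum_antidiagonal:
  fixes k :: nat
  shows "(\<Sum>(a, b)\<in>{(a, b). a + b = k}. g a b) = (\<Sum>a\<le>k. g a (k - a))"
  by (rule sum.reindex_bij_witness[of _ "\<lambda>a. (a, k - a)" fst]) auto

theorem proposition2p7:
  fixes n :: nat and p q :: "real poly" and \<xi> :: real
  assumes "degree p \<le> n" and "degree q \<le> n"
  shows "apolar n (subst_var p var_s * subst_var q var_t) (apolar_kernel n (cnst \<xi>) (var_s + var_t))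
           = (\<Sum>(a, b)\<in>{(a, b). a + b \<le> n}.
                coeff p a * coeff q b *
                (real ((a + b) choose a) / (real (n choose a) * real (n choose b))) *
                real (n choose (a + b)) * \<xi> ^ (a + b))
       \<and> (\<Sum>(a, b)\<in>{(a, b). a + b \<le> n}.
                coeff p a * coeff q b *
                (real ((a + b) choose a) / (real (n choose a) * real (n choose b))) *
                real (n choose (a + b)) * \<xi> ^ (a + b))
           = poly (ff_add_conv n p q) \<xi>"
proof -
  define T where "T a b = coeff p a * coeff q b *
      (real ((a + b) choose a) / (real (n choose a) * real (n choose b))) *
      real (n choose (a + b)) * \<xi> ^ (a + b)" for a b
  have "apolar n (subst_var p var_s * subst_var q var_t) (apolar_kernel n (cnst \<xi>) (var_s + var_t))
      = (\<Sum>a\<le>n. \<Sum>b\<le>n. if a + b \<le> n then T a b else 0)"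
    by (auto simp: apolar_eq_diagonal_sum coeff_st_product coeff_st_kernel T_def intro!: sum.cong)
  also have "\<dots> = (\<Sum>(a, b)\<in>{..n} \<times> {..n}. if a + b \<le> n then T a b else 0)"
    by (simp add: sum.cartesian_product)
  also have "\<dots> = (\<Sum>(a, b)\<in>{(a, b). a + b \<le> n}. T a b)"
    \<comment> \<open>The triangle lies inside the square, and the guarded summand vanishes on the
      rest.\<close>
    by (rule sum.mono_neutral_cong_right) (auto split: if_splits)
  finally have apolar: "apolar n (subst_var p var_s * subst_var q var_t)
      (apolar_kernel n (cnst \<xi>) (var_s + var_t)) = (\<Sum>(a, b)\<in>{(a, b). a + b \<le> n}. T a b)" .
  have "(\<Sum>(a, b)\<in>{(a, b). a + b \<le> n}. T a b) = (\<Sum>k\<le>n. \<Sum>a\<le>k. T a (k - a))"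
    by (rule sum.triangle_reindex_eq)
  \<comment> \<open>On the antidiagonal a + b = k, the factor C(n,k) \<xi>^k is common to all terms,
    leaving C(k,a) times the two normalized coefficients.\<close>
  also have "\<dots> = poly (ff_add_conv n p q) \<xi>"
    by (auto simp: ff_add_conv_def poly_sum poly_monom sum_antidiagonal beta_coeff_def T_def
        sum_distrib_left sum_distrib_right intro!: sum.cong)
  finally show ?thesis
    using apolar by (simp add: T_def)
qed

end
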